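(* For $n\ge 3$ let $S_2(n,1)$ be the $1$-out $2$-complex on the vertex set $[n]$. Then \[\frac{\dim H_1(S_2(n,1),\mathbb{F}_2)}{n^2}\] converges to $0$ in probability as $n\to\infty$.
   Context: The $1$-out $2$-complex $S_2(n,1)$ is the random $2$-dimensional simplicial complex obtained as follows: start with the complete graph on $[n]=\{1,\dots,n\}$, and independently for each edge $\{u,v\}$ choose a vertex $w\in[n]\setminus\{u,v\}$ uniformly at random and add the triangular face $\{u,v,w\}$; if a triangle is chosen at several edges, only one copy is kept. *)

theory Defs
  imports
    "Jordan_Normal_Form.VS_Connect"
    "HOL-Algebra.AbelCoset"
    "HOL-Library.Z2"
    "HOL-Probability.Probability"
begin

section \<open>Quotient modules\<close>

text \<open>
  The scalar action on cosets is \<open>a \<cdot> (N + x) = N + a \<cdot> x\<close>; the union over all representatives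
  avoids choosing one. The fields \<open>mult\<close> and \<open>one\<close> of the module record are irrelevant.
\<close>

definition quot_module :: "('a, 'b, 'm) module_scheme \<Rightarrow> 'b set \<Rightarrow> ('a, 'b set) module" where
  "quot_module M N = \<lparr>
     carrier = a_rcosets\<^bsub>M\<^esub> N,
     monoid.mult = undefined,
     one = undefined,
     zero = N,
     add = set_add M,
     module.smult = (\<lambda>a X. \<Union>x\<in>X. N +>\<^bsub>M\<^esub> (a \<odot>\<^bsub>M\<^esub> x))\<rparr>"


section \<open>Simplicial homology with coefficients in the two-element field\<close>

text \<open>
  An abstract simplicial complex is given by its set of nonempty finite faces. The
  two-element field is the type \<^typ>\<open>bit\<close>.
\<close>

definition simplicial_complex :: "'v set set \<Rightarrow> bool" where
  "simplicial_complex K \<longleftrightarrow>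
     (\<forall>\<sigma>\<in>K. finite \<sigma> \<and> \<sigma> \<noteq> {} \<and> (\<forall>\<tau>. \<tau> \<subseteq> \<sigma> \<longrightarrow> \<tau> \<noteq> {} \<longrightarrow> \<tau> \<in> K))"

definition faces :: "'v set set \<Rightarrow> nat \<Rightarrow> 'v set set" where
  "faces K k = {\<sigma> \<in> K. card \<sigma> = Suc k}"

definition F2_chains :: "'v set set \<Rightarrow> nat \<Rightarrow> (bit, 'v set \<Rightarrow> bit) module" where
  "F2_chains K k = \<lparr>
     carrier = {c. finite {\<sigma>. c \<sigma> \<noteq> 0} \<and> {\<sigma>. c \<sigma> \<noteq> 0} \<subseteq> faces K k},
     monoid.mult = undefined,
     one = undefined,
     zero = (\<lambda>_. 0),
     add = (\<lambda>c d \<sigma>. c \<sigma> + d \<sigma>),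
     module.smult = (\<lambda>a c \<sigma>. a * c \<sigma>)\<rparr>"

text \<open>
  One operator serves all degrees: a \<open>k\<close>-face is sent to the sum of its facets. No orientation is
  needed since \<open>-1 = 1\<close>. The value at the empty set is \<open>0\<close>, that is, the boundary of a
  vertex is \<open>0\<close> (unreduced homology).
\<close>

definition F2_boundary :: "('v set \<Rightarrow> bit) \<Rightarrow> ('v set \<Rightarrow> bit)" where
  "F2_boundary c = (\<lambda>\<tau>. if \<tau> = {} then 0
     else \<Sum>\<sigma> | c \<sigma> \<noteq> 0 \<and> \<tau> \<subset> \<sigma> \<and> card \<sigma> = Suc (card \<tau>). c \<sigma>)"

definition F2_cycles :: "'v set set \<Rightarrow> nat \<Rightarrow> (bit, 'v set \<Rightarrow> bit) module" where
  "F2_cycles K k = (F2_chains K k)\<lparr>carrier := {c \<in> carrier (F2_chains K k). F2_boundary c = (\<lambda>_. 0)}\<rparr>"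

definition F2_boundaries :: "'v set set \<Rightarrow> nat \<Rightarrow> ('v set \<Rightarrow> bit) set" where
  "F2_boundaries K k = F2_boundary ` carrier (F2_chains K (Suc k))"

definition F2_homology :: "'v set set \<Rightarrow> nat \<Rightarrow> (bit, ('v set \<Rightarrow> bit) set) module" where
  "F2_homology K k = quot_module (F2_cycles K k) (F2_boundaries K k)"

definition F2_homology_dim :: "'v set set \<Rightarrow> nat \<Rightarrow> nat" where
  "F2_homology_dim K k = vectorspace.dim class_ring (F2_homology K k)"


section \<open>The 1-out 2-complex\<close>

definition edges :: "nat \<Rightarrow> nat set set" where
  "edges n = {e. e \<subseteq> {1..n} \<and> card e = 2}"

definition complete_graph :: "nat \<Rightarrow> nat set set" where
  "complete_graph n = {{v} | v. v \<in> {1..n}} \<union> edges n"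

definition one_out_complex :: "nat \<Rightarrow> (nat set \<Rightarrow> nat) \<Rightarrow> nat set set" where
  "one_out_complex n f = complete_graph n \<union> {insert (f e) e | e. e \<in> edges n}"

text \<open>
  The distribution of \<open>S\<^sub>2(n,1)\<close>. It is meaningful only for \<open>n \<ge> 3\<close>, so that every set
  \<open>{1..n} - e\<close> is nonempty. The second argument of \<^const>\<open>Pi_pmf\<close> is the value of the random
  function outside of \<^term>\<open>edges n\<close>, which is never used.
\<close>

definition S2_1 :: "nat \<Rightarrow> nat set set pmf" where
  "S2_1 n = map_pmf (one_out_complex n)
     (Pi_pmf (edges n) 0 (\<lambda>e. pmf_of_set ({1..n} - e)))"


section \<open>Homology is a vector space\<close>

context
  notes bit_not_zero_iff [simp del] bit_not_one_iff [simp del]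
    add_bit_eq_xor [simp del] mult_bit_eq_and [simp del] sum_constant [simp del]
begin

lemma bit_add_self: "a + a = (0 :: bit)"
  by (cases a) simp_all

lemma bit_add_nonzero: "a + b \<noteq> 0 \<Longrightarrow> a \<noteq> 0 \<or> b \<noteq> (0 :: bit)"
  by auto

lemma F2_boundary_nonzeroE:
  assumes "F2_boundary c \<tau> \<noteq> 0"
  obtains \<sigma> where "\<tau> \<noteq> {}" "c \<sigma> \<noteq> 0" "\<tau> \<subset> \<sigma>" "card \<sigma> = Suc (card \<tau>)"
proof -
  from assms have "\<tau> \<noteq> {}" and "(\<Sum>\<sigma> | c \<sigma> \<noteq> 0 \<and> \<tau> \<subset> \<sigma> \<and> card \<sigma> = Suc (card \<tau>). c \<sigma>) \<noteq> 0"
    by (auto simp: F2_boundary_def split: if_splits)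
  thus ?thesis using that sum.not_neutral_contains_not_neutral by (metis (mono_tags, lifting) mem_Collect_eq)
qed

lemma quot_module_smult_coset:
  assumes "Module.module R M" "Module.submodule N R M" "a \<in> carrier R" "x \<in> carrier M"
  shows "a \<odot>\<^bsub>quot_module M N\<^esub> (N +>\<^bsub>M\<^esub> x) = N +>\<^bsub>M\<^esub> (a \<odot>\<^bsub>M\<^esub> x)"
proof -
  interpret Module.module R M by fact
  interpret N: Module.submodule N R M by fact
  interpret A: abelian_subgroup N M
    by (rule abelian_subgroupI3) (use N.subgroup_axioms in \<open>auto simp: additive_subgroup_def abelian_group_axioms\<close>)
  have "N +>\<^bsub>M\<^esub> (a \<odot>\<^bsub>M\<^esub> y) = N +>\<^bsub>M\<^esub> (a \<odot>\<^bsub>M\<^esub> x)" if "y \<in> N +>\<^bsub>M\<^esub> x" for y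
  proof -
    from that obtain h where h: "h \<in> N" "y = h \<oplus>\<^bsub>M\<^esub> x" by (auto simp: a_r_coset_def')
    hence "a \<odot>\<^bsub>M\<^esub> y = a \<odot>\<^bsub>M\<^esub> h \<oplus>\<^bsub>M\<^esub> a \<odot>\<^bsub>M\<^esub> x" using assms A.a_subset smult_r_distr by auto
    hence "a \<odot>\<^bsub>M\<^esub> y \<in> N +>\<^bsub>M\<^esub> (a \<odot>\<^bsub>M\<^esub> x)" using N.smult_closed h assms by (auto simp: a_r_coset_def')
    thus ?thesis using A.a_repr_independence'[OF _ smult_closed[OF assms(3,4)]] by simp
  qed
  moreover have "x \<in> N +>\<^bsub>M\<^esub> x" using assms A.a_rcos_self by blast
  ultimately have "(\<Union>y\<in>N +>\<^bsub>M\<^esub> x. N +>\<^bsub>M\<^esub> (a \<odot>\<^bsub>M\<^esub> y)) = N +>\<^bsub>M\<^esub> (a \<odot>\<^bsub>M\<^esub> x)"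
    by blast
  thus ?thesis by (simp add: quot_module_def)
qed

lemma module_quot_module:
  assumes "Module.module R M" "Module.submodule N R M"
  shows "Module.module R (quot_module M N)"
proof -
  interpret Module.module R M by fact
  interpret N: Module.submodule N R M by fact
  interpret A: abelian_subgroup N M
    by (rule abelian_subgroupI3) (use N.subgroup_axioms in \<open>auto simp: additive_subgroup_def abelian_group_axioms\<close>)
  let ?Q = "quot_module M N"
  have Q: "carrier ?Q = a_rcosets\<^bsub>M\<^esub> N" "add ?Q = set_add M" "zero ?Q = N"
    by (simp_all add: quot_module_def)
  have car: "X \<in> carrier ?Q \<longleftrightarrow> (\<exists>x\<in>carrier M. X = N +>\<^bsub>M\<^esub> x)" for X
    by (auto simp: Q A_RCOSETS_def' a_r_coset_def)
  have ag: "abelian_group ?Q"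
  proof (rule abelian_groupI)
    show "\<exists>y\<in>carrier ?Q. y \<oplus>\<^bsub>?Q\<^esub> x = \<zero>\<^bsub>?Q\<^esub>" if "x \<in> carrier ?Q" for x
      using that unfolding Q by (meson A.a_setinv_closed A.a_rcosets_inv_mult_group_eq)
    show "\<zero>\<^bsub>?Q\<^esub> \<in> carrier ?Q" unfolding Q by (rule A.a_subgroup_in_rcosets)
    show "\<zero>\<^bsub>?Q\<^esub> \<oplus>\<^bsub>?Q\<^esub> x = x" if "x \<in> carrier ?Q" for x
      using that unfolding Q by (rule A.rcosets_add_eq)
  qed (auto simp: Q A_RCOSETS_def' A.a_rcos_sum a_ac)
  have sm: "a \<odot>\<^bsub>?Q\<^esub> (N +>\<^bsub>M\<^esub> x) = N +>\<^bsub>M\<^esub> (a \<odot>\<^bsub>M\<^esub> x)"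
    if "a \<in> carrier R" "x \<in> carrier M" for a x
    using quot_module_smult_coset[OF assms that] .
  show ?thesis
    by (rule moduleI[OF is_cring ag])
      (auto simp: car sm Q(2) A.a_rcos_sum smult_assoc1 smult_l_distr smult_r_distr)
qed

lemma F2_boundary_eq_sum:
  assumes "finite S" "\<And>\<sigma>. c \<sigma> \<noteq> 0 \<Longrightarrow> \<sigma> \<in> S" "\<tau> \<noteq> {}"
  shows "F2_boundary c \<tau> = (\<Sum>\<sigma>\<in>S. if \<tau> \<subset> \<sigma> \<and> card \<sigma> = Suc (card \<tau>) then c \<sigma> else 0)"
  unfolding F2_boundary_def using assms
  by (auto simp: sum.inter_filter[symmetric] intro!: sum.mono_neutral_left)

lemma F2_chains_simps [simp]:
  "c \<in> carrier (F2_chains K k) \<longleftrightarrow> finite {\<sigma>. c \<sigma> \<noteq> 0} \<and> {\<sigma>. c \<sigma> \<noteq> 0} \<subseteq> faces K k"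
  "add (F2_chains K k) = (\<lambda>c d \<sigma>. c \<sigma> + d \<sigma>)" "zero (F2_chains K k) = (\<lambda>_. 0)"
  "Module.module.smult (F2_chains K k) = (\<lambda>a c \<sigma>. a * c \<sigma>)"
  by (simp_all add: F2_chains_def)

lemma field_F2: "field (class_ring :: bit ring)"
  by (rule class_field.field_axioms)

lemma module_F2_chains: "Module.module (class_ring :: bit ring) (F2_chains K k)"
proof (rule moduleI)
  show "cring (class_ring :: bit ring)" using field_F2 by (simp add: field.axioms(1) domain.axioms(1))
  have fin: "finite {\<sigma>. x \<sigma> + y \<sigma> \<noteq> (0::bit)}" if "finite {\<sigma>. x \<sigma> \<noteq> 0}" "finite {\<sigma>. y \<sigma> \<noteq> 0}" for x y :: "'a set \<Rightarrow> bit"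
    by (rule finite_subset[OF _ finite_UnI[OF that]]) auto
  show "abelian_group (F2_chains K k)"
  proof (rule abelian_groupI)
    fix x assume "x \<in> carrier (F2_chains K k)"
    thus "\<exists>y\<in>carrier (F2_chains K k). y \<oplus>\<^bsub>F2_chains K k\<^esub> x = \<zero>\<^bsub>F2_chains K k\<^esub>" 
       by (intro bexI[of _ x]) (auto simp: fun_eq_iff bit_add_self)
  qed (auto simp: fun_eq_iff algebra_simps fin subset_iff dest!: bit_add_nonzero)
qed (auto simp: fun_eq_iff algebra_simps )

lemma two_intermediate:
  assumes "finite \<sigma>" "\<rho> \<subseteq> \<sigma>" "card \<sigma> = Suc (Suc (card \<rho>))"
  shows "card {\<tau>. \<rho> \<subset> \<tau> \<and> card \<tau> = Suc (card \<rho>) \<and> \<tau> \<subset> \<sigma> \<and> card \<sigma> = Suc (card \<tau>)} = 2"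
proof -
  have fr: "finite \<rho>" using assms finite_subset by blast
  have "card (\<sigma> - \<rho>) = 2" using assms fr by (simp add: card_Diff_subset)
  then obtain a b where ab: "\<sigma> - \<rho> = {a, b}" "a \<noteq> b" by (auto simp: card_2_iff)
  have s: "\<sigma> = insert a (insert b \<rho>)" "a \<notin> \<rho>" "b \<notin> \<rho>" using ab assms by auto
  have "{\<tau>. \<rho> \<subset> \<tau> \<and> card \<tau> = Suc (card \<rho>) \<and> \<tau> \<subset> \<sigma> \<and> card \<sigma> = Suc (card \<tau>)} = {insert a \<rho>, insert b \<rho>}"
  proof (intro equalityI subsetI)
    fix \<tau> assume "\<tau> \<in> {\<tau>. \<rho> \<subset> \<tau> \<and> card \<tau> = Suc (card \<rho>) \<and> \<tau> \<subset> \<sigma> \<and> card \<sigma> = Suc (card \<tau>)}"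
    hence t: "\<rho> \<subset> \<tau>" "\<tau> \<subset> \<sigma>" by auto
    thus "\<tau> \<in> {insert a \<rho>, insert b \<rho>}" unfolding s(1) by auto
  next
    fix \<tau> assume "\<tau> \<in> {insert a \<rho>, insert b \<rho>}"
    thus "\<tau> \<in> {\<tau>. \<rho> \<subset> \<tau> \<and> card \<tau> = Suc (card \<rho>) \<and> \<tau> \<subset> \<sigma> \<and> card \<sigma> = Suc (card \<tau>)}"
      using s fr ab assms by auto
  qed
  moreover have "insert a \<rho> \<noteq> insert b \<rho>" using s ab by auto
  ultimately show ?thesis by simp
qed

lemma F2_boundary_finite:
  assumes "finite {\<sigma>. c \<sigma> \<noteq> 0}" "\<And>\<sigma>. c \<sigma> \<noteq> 0 \<Longrightarrow> finite \<sigma>"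
  shows "finite {\<tau>. F2_boundary c \<tau> \<noteq> 0}"
proof (rule finite_subset)
  show "{\<tau>. F2_boundary c \<tau> \<noteq> 0} \<subseteq> (\<Union>\<sigma>\<in>{\<sigma>. c \<sigma> \<noteq> 0}. Pow \<sigma>)"
    by (auto elim!: F2_boundary_nonzeroE)
qed (use assms in auto)

lemma F2_boundary_boundary:
  assumes "finite {\<sigma>. c \<sigma> \<noteq> 0}" "\<And>\<sigma>. c \<sigma> \<noteq> 0 \<Longrightarrow> finite \<sigma>"
  shows "F2_boundary (F2_boundary c) = (\<lambda>_. 0)"
proof
  fix \<rho> :: "'a set"
  show "F2_boundary (F2_boundary c) \<rho> = 0"
  proof (cases "\<rho> = {}")
    case False
    let ?S = "{\<sigma>. c \<sigma> \<noteq> 0}" let ?T = "(\<Union>\<sigma>\<in>?S. Pow \<sigma>)"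
    let ?f = "\<lambda>\<tau> \<sigma> :: 'a set. \<tau> \<subset> \<sigma> \<and> card \<sigma> = Suc (card \<tau>)"
    have T: "finite ?T" using assms by auto
    have "F2_boundary (F2_boundary c) \<rho> = (\<Sum>\<tau>\<in>?T. if ?f \<rho> \<tau> then F2_boundary c \<tau> else 0)"
      by (rule F2_boundary_eq_sum[OF T _ False])
        (auto elim!: F2_boundary_nonzeroE)
    also have "\<dots> = (\<Sum>\<tau>\<in>?T. \<Sum>\<sigma>\<in>?S. if ?f \<rho> \<tau> \<and> ?f \<tau> \<sigma> then c \<sigma> else 0)"
    proof (rule sum.cong[OF refl])
      fix \<tau>
      show "(if ?f \<rho> \<tau> then F2_boundary c \<tau> else 0) = (\<Sum>\<sigma>\<in>?S. if ?f \<rho> \<tau> \<and> ?f \<tau> \<sigma> then c \<sigma> else 0)"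
      proof (cases "?f \<rho> \<tau>")
        case True
        hence "\<tau> \<noteq> {}" by auto
        hence "F2_boundary c \<tau> = (\<Sum>\<sigma>\<in>?S. if ?f \<tau> \<sigma> then c \<sigma> else 0)"
          by (intro F2_boundary_eq_sum[OF assms(1)]) auto
        thus ?thesis using True by simp
      next
        case n: False
        have "(\<Sum>\<sigma>\<in>?S. if ?f \<rho> \<tau> \<and> ?f \<tau> \<sigma> then c \<sigma> else 0) = 0"
          by (intro sum.neutral ballI) (simp only: n if_False simp_thms)
        thus ?thesis by (simp only: n if_False)
      qed
    qed
    also have "\<dots> = (\<Sum>\<sigma>\<in>?S. \<Sum>\<tau>\<in>?T. if ?f \<rho> \<tau> \<and> ?f \<tau> \<sigma> then c \<sigma> else 0)"
      by (rule sum.swap)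
    also have "\<dots> = (\<Sum>\<sigma>\<in>?S. 0)"
    proof (rule sum.cong[OF refl])
      fix \<sigma> assume s: "\<sigma> \<in> ?S"
      have "(\<Sum>\<tau>\<in>?T. if ?f \<rho> \<tau> \<and> ?f \<tau> \<sigma> then c \<sigma> else 0) = (\<Sum>\<tau>\<in>{\<tau>\<in>?T. ?f \<rho> \<tau> \<and> ?f \<tau> \<sigma>}. c \<sigma>)"
        by (rule sum.inter_filter[OF T, symmetric])
      also have "{\<tau>\<in>?T. ?f \<rho> \<tau> \<and> ?f \<tau> \<sigma>} = {\<tau>. ?f \<rho> \<tau> \<and> ?f \<tau> \<sigma>}" using s by auto
      also have "(\<Sum>\<tau>\<in>{\<tau>. ?f \<rho> \<tau> \<and> ?f \<tau> \<sigma>}. c \<sigma>) = 0"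
      proof (cases "\<rho> \<subseteq> \<sigma> \<and> card \<sigma> = Suc (Suc (card \<rho>))")
        case True
        hence "card {\<tau>. ?f \<rho> \<tau> \<and> ?f \<tau> \<sigma>} = 2" using two_intermediate[of \<sigma> \<rho>] assms(2) s by auto
        thus ?thesis by (simp add: sum_constant)
      next
        case False
        hence e: "{\<tau>. ?f \<rho> \<tau> \<and> ?f \<tau> \<sigma>} = {}" by auto
        show ?thesis unfolding e by simp
      qed
      finally show "(\<Sum>\<tau>\<in>?T. if ?f \<rho> \<tau> \<and> ?f \<tau> \<sigma> then c \<sigma> else 0) = 0" .
    qed
    finally show ?thesis by simp
  qed (simp add: F2_boundary_def)
qed

lemma F2_boundary_add:
  assumes "finite {\<sigma>. c \<sigma> \<noteq> 0}" "finite {\<sigma>. d \<sigma> \<noteq> 0}"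
  shows "F2_boundary (\<lambda>\<sigma>. c \<sigma> + d \<sigma>) = (\<lambda>\<tau>. F2_boundary c \<tau> + F2_boundary d \<tau>)"
proof
  fix \<tau> :: "'a set"
  let ?S = "{\<sigma>. c \<sigma> \<noteq> 0} \<union> {\<sigma>. d \<sigma> \<noteq> 0}"
  show "F2_boundary (\<lambda>\<sigma>. c \<sigma> + d \<sigma>) \<tau> = F2_boundary c \<tau> + F2_boundary d \<tau>"
  proof (cases "\<tau> = {}")
    case False
    have S: "finite ?S" using assms by auto
    have 1: "F2_boundary c \<tau> = (\<Sum>\<sigma>\<in>?S. if \<tau> \<subset> \<sigma> \<and> card \<sigma> = Suc (card \<tau>) then c \<sigma> else 0)"
      and 2: "F2_boundary d \<tau> = (\<Sum>\<sigma>\<in>?S. if \<tau> \<subset> \<sigma> \<and> card \<sigma> = Suc (card \<tau>) then d \<sigma> else 0)"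
      and 3: "F2_boundary (\<lambda>\<sigma>. c \<sigma> + d \<sigma>) \<tau> = (\<Sum>\<sigma>\<in>?S. if \<tau> \<subset> \<sigma> \<and> card \<sigma> = Suc (card \<tau>) then c \<sigma> + d \<sigma> else 0)"
      by (rule F2_boundary_eq_sum[OF S _ False]; auto)+
    show ?thesis unfolding 1 2 3 sum.distrib[symmetric] by (rule sum.cong) auto
  qed (simp add: F2_boundary_def)
qed

lemma F2_boundary_zero [simp]: "F2_boundary (\<lambda>_. 0) = (\<lambda>_. 0)"
  by (auto simp: F2_boundary_def)

lemma F2_boundary_smult: "F2_boundary (\<lambda>\<sigma>. a * c \<sigma>) = (\<lambda>\<tau>. a * F2_boundary c \<tau>)"
  by (cases a) (auto simp: F2_boundary_def)

lemma F2_boundary_in_chains: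
  assumes "simplicial_complex K" "c \<in> carrier (F2_chains K (Suc k))"
  shows "F2_boundary c \<in> carrier (F2_chains K k)"
proof -
  have fin: "finite {\<tau>. F2_boundary c \<tau> \<noteq> 0}"
    using assms by (intro F2_boundary_finite) (auto simp: simplicial_complex_def faces_def)
  have "\<tau> \<in> faces K k" if "F2_boundary c \<tau> \<noteq> 0" for \<tau>
  proof -
    from that obtain \<sigma> where "\<tau> \<noteq> {}" "c \<sigma> \<noteq> 0" "\<tau> \<subset> \<sigma>" "card \<sigma> = Suc (card \<tau>)"
      by (auto elim!: F2_boundary_nonzeroE)
    moreover from this assms(2) have "\<sigma> \<in> K" "card \<sigma> = Suc (Suc k)" by (auto simp: faces_def)
    ultimately show ?thesis using assms(1) unfolding simplicial_complex_def faces_def by auto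
  qed
  thus ?thesis using fin by auto
qed

lemma module_F2_cycles: "Module.module (class_ring :: bit ring) (F2_cycles K k)"
proof (rule moduleI)
  show "cring (class_ring :: bit ring)" using field_F2 by (simp add: field.axioms(1) domain.axioms(1))
  have fin: "finite {\<sigma>. x \<sigma> + y \<sigma> \<noteq> (0::bit)}" if "finite {\<sigma>. x \<sigma> \<noteq> 0}" "finite {\<sigma>. y \<sigma> \<noteq> 0}" for x y :: "'a set \<Rightarrow> bit"
    by (rule finite_subset[OF _ finite_UnI[OF that]]) auto
  show "abelian_group (F2_cycles K k)"
  proof (rule abelian_groupI)
    fix x assume "x \<in> carrier (F2_cycles K k)"
    thus "\<exists>y\<in>carrier (F2_cycles K k). y \<oplus>\<^bsub>F2_cycles K k\<^esub> x = \<zero>\<^bsub>F2_cycles K k\<^esub>" 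
       by (intro bexI[of _ x]) (auto simp: fun_eq_iff F2_cycles_def bit_add_self)
  qed (auto simp: F2_cycles_def F2_boundary_add fun_eq_iff algebra_simps fin subset_iff dest!: bit_add_nonzero)
qed (auto simp: F2_cycles_def F2_boundary_smult fun_eq_iff algebra_simps )

lemma submodule_F2_boundaries:
  assumes "simplicial_complex K"
  shows "Module.submodule (F2_boundaries K k) (class_ring :: bit ring) (F2_cycles K k)"
proof -
  interpret Z: Module.module "class_ring :: bit ring" "F2_cycles K k" by (rule module_F2_cycles)
  interpret C: Module.module "class_ring :: bit ring" "F2_chains K (Suc k)" by (rule module_F2_chains)
  have B: "F2_boundaries K k \<subseteq> carrier (F2_cycles K k)"
  proof
    fix b assume "b \<in> F2_boundaries K k"
    then obtain c where c: "c \<in> carrier (F2_chains K (Suc k))" "b = F2_boundary c" by (auto simp: F2_boundaries_def)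
    have "F2_boundary b = (\<lambda>_. 0)" unfolding c(2) using c(1) assms
      by (intro F2_boundary_boundary) (auto simp: simplicial_complex_def faces_def)
    thus "b \<in> carrier (F2_cycles K k)" using F2_boundary_in_chains[OF assms c(1)] c(2) by (simp add: F2_cycles_def)
  qed
  have add: "b \<oplus>\<^bsub>F2_cycles K k\<^esub> b' \<in> F2_boundaries K k" if "b \<in> F2_boundaries K k" "b' \<in> F2_boundaries K k" for b b'
  proof -
    from that obtain c c' where c: "c \<in> carrier (F2_chains K (Suc k))" "b = F2_boundary c" 
      "c' \<in> carrier (F2_chains K (Suc k))" "b' = F2_boundary c'" by (auto simp: F2_boundaries_def)
    have "b \<oplus>\<^bsub>F2_cycles K k\<^esub> b' = F2_boundary (c \<oplus>\<^bsub>F2_chains K (Suc k)\<^esub> c')"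
      using c by (simp add: F2_cycles_def F2_boundary_add )
    thus ?thesis using C.a_closed[OF c(1,3)] unfolding F2_boundaries_def by (rule image_eqI)
  qed
  have smult: "a \<odot>\<^bsub>F2_cycles K k\<^esub> b \<in> F2_boundaries K k" if "b \<in> F2_boundaries K k" for a b
  proof -
    from that obtain c where c: "c \<in> carrier (F2_chains K (Suc k))" "b = F2_boundary c" by (auto simp: F2_boundaries_def)
    have "a \<odot>\<^bsub>F2_cycles K k\<^esub> b = F2_boundary (a \<odot>\<^bsub>F2_chains K (Suc k)\<^esub> c)"
      using c by (simp add: F2_cycles_def F2_boundary_smult )
    moreover have "a \<odot>\<^bsub>F2_chains K (Suc k)\<^esub> c \<in> carrier (F2_chains K (Suc k))"
      by (rule C.smult_closed[OF _ c(1)]) simp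
    ultimately show ?thesis unfolding F2_boundaries_def by (rule image_eqI)
  qed
  have zero: "\<zero>\<^bsub>F2_cycles K k\<^esub> \<in> F2_boundaries K k"
    unfolding F2_boundaries_def by (rule image_eqI[of _ _ "\<lambda>_. 0"]) (auto simp: F2_cycles_def)
  have inv: "\<ominus>\<^bsub>F2_cycles K k\<^esub> b = b" if "b \<in> F2_boundaries K k" for b
    by (rule Z.minus_equality) (use that B in \<open>auto simp: F2_cycles_def fun_eq_iff bit_add_self\<close>)
  show ?thesis
    by (rule Z.submoduleI) (use B zero add smult inv in auto)
qed

lemma vectorspace_F2_homology:
  assumes "simplicial_complex K"
  shows "vectorspace (class_ring :: bit ring) (F2_homology K k)"
  unfolding vectorspace_def F2_homology_def
  using module_quot_module[OF module_F2_cycles submodule_F2_boundaries[OF assms]] field_F2 by blast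

lemma simplicial_complex_one_out_complex:
  assumes "\<And>e. e \<in> edges n \<Longrightarrow> f e \<in> {1..n} - e"
  shows "simplicial_complex (one_out_complex n f)"
  unfolding simplicial_complex_def
proof (intro ballI conjI allI impI)
  fix \<sigma> assume s: "\<sigma> \<in> one_out_complex n f"
  have sub: "\<sigma> \<subseteq> {1..n}" using s assms by (auto simp: one_out_complex_def complete_graph_def edges_def)
  thus fs: "finite \<sigma>" by (rule finite_subset) auto
  show "\<sigma> \<noteq> {}" using s by (auto simp: one_out_complex_def complete_graph_def edges_def)
  have c3: "card \<sigma> \<le> 3" using s
    by (auto simp: one_out_complex_def complete_graph_def edges_def intro: order.trans[OF card_insert_le_m1])
  fix \<tau> assume t: "\<tau> \<subseteq> \<sigma>" "\<tau> \<noteq> {}"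
  have ft: "finite \<tau>" using t fs finite_subset by blast
  show "\<tau> \<in> one_out_complex n f"
  proof (cases "\<tau> = \<sigma>")
    case False
    hence "card \<tau> < card \<sigma>" using t fs by (simp add: psubset_card_mono psubsetI)
    moreover have "card \<tau> \<noteq> 0" using t ft by simp
    ultimately have "card \<tau> = 1 \<or> card \<tau> = 2" using c3 by linarith
    thus ?thesis
    proof
      assume "card \<tau> = 1"
      then obtain v where "\<tau> = {v}" by (rule card_1_singletonE)
      thus ?thesis using t sub by (auto simp: one_out_complex_def complete_graph_def)
    next
      assume "card \<tau> = 2"
      hence "\<tau> \<in> edges n" using t sub by (auto simp: edges_def)
      thus ?thesis by (simp add: one_out_complex_def complete_graph_def)
    qed
  qed (use s in simp)
qed

end

end

theory Submission
  imports Defs "HOL-Real_Asymp.Real_Asymp"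
begin

text \<open>
  By duality, \<open>2 ^ dim H\<^sub>1\<close> is at most the number of 1-cocycles, that is, of graphs \<open>G\<close> on \<open>[n]\<close>
  such that every chosen triangle contains an even number of edges of \<open>G\<close>. By Markov's inequality
  it suffices to bound the expected number of cocycles by \<open>2 ^ o(n\<^sup>2)\<close>.

  The probability that \<open>G\<close> is a cocycle is essentially \<open>\<Prod>e. (if e \<in> G then q e else 1 - q e)\<close>, where
  \<open>q {u, v}\<close> is the fraction of vertices adjacent in \<open>G\<close> to exactly one of \<open>u\<close> and \<open>v\<close>. For a
  weight \<open>q\<close> not depending on \<open>G\<close>, the sum of these products over all \<open>G\<close> is \<open>1\<close>. Up to a small
  average error, \<open>q\<close> is determined by the neighbourhoods of a bounded number \<open>s\<close> of sampled vertices,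
  so only \<open>2 ^ (s * n)\<close> different weights matter. Smoothing the weights, to keep them away from \<open>0\<close>,
  makes the error in \<open>q\<close> cost only a factor \<open>exp (\<delta> * n\<^sup>2)\<close>.
\<close>

text \<open>Expansion of the product on the right: \<open>G\<close> records the factors from which
  \<open>f e\<close> is picked.\<close>

lemma sum_Pow_prod_if:
  fixes f g :: "'a \<Rightarrow> 'b :: comm_semiring_1"
  assumes "finite E"
  shows "(\<Sum>G\<in>Pow E. \<Prod>e\<in>E. if e \<in> G then f e else g e) = (\<Prod>e\<in>E. f e + g e)"
proof -
  have "(\<Prod>e\<in>E. if e \<in> G then f e else g e) = (\<Prod>e\<in>G. f e) * (\<Prod>e\<in>E - G. g e)" if "G \<subseteq> E" for G
  proof -
    have "E \<inter> G = G" "E \<inter> - G = E - G" using that by auto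
    thus ?thesis using prod.If_cases[OF assms, of "\<lambda>e. e \<in> G" f g] by simp
  qed
  thus ?thesis by (simp add: prod_add[OF assms])
qed

section \<open>Sampling\<close>

text \<open>Greedy derandomisation of the second moment computation for \<open>s\<close> independent samples from
  \<open>W\<close>: averaged over \<open>w\<close>, appending \<open>w\<close> to the sample increases the energy by at most \<open>card E\<close>.\<close>

lemma exists_sample_small_energy:
  fixes y :: "'e \<Rightarrow> 'w \<Rightarrow> real"
  assumes "finite W" "W \<noteq> {}"
    and mean: "\<And>e. e \<in> E \<Longrightarrow> (\<Sum>w\<in>W. y e w) = 0"
    and bound: "\<And>e w. e \<in> E \<Longrightarrow> w \<in> W \<Longrightarrow> \<bar>y e w\<bar> \<le> 1"
  shows "\<exists>xs. length xs = s \<and> set xs \<subseteq> W \<and>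
    (\<Sum>e\<in>E. (\<Sum>w\<leftarrow>xs. y e w)\<^sup>2) \<le> real s * real (card E)"
proof (induction s)
  case 0
  show ?case by simp
next
  case (Suc s)
  then obtain xs where xs: "length xs = s" "set xs \<subseteq> W"
    "(\<Sum>e\<in>E. (\<Sum>w\<leftarrow>xs. y e w)\<^sup>2) \<le> real s * real (card E)" by blast
  define a where "a e = (\<Sum>w\<leftarrow>xs. y e w)" for e
  have "(\<Sum>w\<in>W. \<Sum>e\<in>E. (y e w + a e)\<^sup>2) = (\<Sum>e\<in>E. \<Sum>w\<in>W. (y e w + a e)\<^sup>2)"
    by (rule sum.swap)
  also have "\<dots> \<le> (\<Sum>e\<in>E. real (card W) * (1 + (a e)\<^sup>2))"
  proof (rule sum_mono)
    fix e assume e: "e \<in> E"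
    have "(\<Sum>w\<in>W. (y e w + a e)\<^sup>2) = (\<Sum>w\<in>W. (y e w)\<^sup>2 + (a e)\<^sup>2 + 2 * a e * y e w)"
      by (simp add: power2_eq_square algebra_simps)
    also have "\<dots> = (\<Sum>w\<in>W. (y e w)\<^sup>2 + (a e)\<^sup>2) + 2 * a e * (\<Sum>w\<in>W. y e w)"
      by (simp add: sum.distrib sum_distrib_left)
    \<comment> \<open>The cross term vanishes because \<open>y e\<close> has mean zero over
      \<open>W\<close>.\<close>
    also have "\<dots> \<le> (\<Sum>w\<in>W. 1 + (a e)\<^sup>2)"
      unfolding mean[OF e] mult_zero_right add_0_right using bound[OF e]
      by (intro sum_mono add_right_mono) (simp add: abs_square_le_1)
    finally show "(\<Sum>w\<in>W. (y e w + a e)\<^sup>2) \<le> real (card W) * (1 + (a e)\<^sup>2)" by simp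
  qed
  also have "\<dots> = (\<Sum>w\<in>W. real (card E) + (\<Sum>e\<in>E. (a e)\<^sup>2))"
    by (simp add: sum_distrib_left[symmetric] sum.distrib)
  \<comment> \<open>Some \<open>w\<close> does no worse than the average; it is the next sample
    point.\<close>
  finally have "\<exists>w\<in>W. (\<Sum>e\<in>E. (y e w + a e)\<^sup>2) \<le> real (card E) + (\<Sum>e\<in>E. (a e)\<^sup>2)"
    using sum_strict_mono[OF assms(1,2)] by (meson not_le)
  then obtain w where w: "w \<in> W" "(\<Sum>e\<in>E. (y e w + a e)\<^sup>2) \<le> real (card E) + (\<Sum>e\<in>E. (a e)\<^sup>2)"
    by blast
  have "(\<Sum>e\<in>E. (\<Sum>w\<leftarrow>w # xs. y e w)\<^sup>2) \<le> real (Suc s) * real (card E)"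
    using w(2) xs(3) by (simp add: a_def algebra_simps)
  thus ?case using w(1) xs by (intro exI[of _ "w # xs"]) auto
qed

section \<open>Counting graphs weighted by the probability of being a cocycle\<close>

definition nbhd :: "nat set set \<Rightarrow> nat \<Rightarrow> nat set" where
  "nbhd G w = {v. {v, w} \<in> G}"

text \<open>For an edge \<open>e\<close> and \<open>w \<notin> e\<close>, the number of edges of \<open>G\<close> in the triangle \<open>insert w e\<close>
  is even if and only if \<open>agrees G e (nbhd G w)\<close>.\<close>

definition agrees :: "nat set set \<Rightarrow> nat set \<Rightarrow> nat set \<Rightarrow> bool" where
  "agrees G e N \<longleftrightarrow> (odd (card (e \<inter> N)) \<longleftrightarrow> e \<in> G)"

text \<open>For a two-element \<open>e\<close> this is \<open>q e\<close> if
  \<open>e \<in> G\<close> and \<open>1 - q e\<close> otherwise, with the endpoints of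
  \<open>e\<close> counted among the \<open>w\<close>.\<close>

definition agree_frac :: "nat \<Rightarrow> nat set set \<Rightarrow> nat set \<Rightarrow> real" where
  "agree_frac n G e = real (card {w \<in> {1..n}. agrees G e (nbhd G w)}) / real n"

text \<open>The sample is a list of vertex sets, not of vertices of a graph: once \<open>L\<close>
  is fixed, \<open>G\<close> enters only through whether \<open>e \<in> G\<close>.\<close>

definition sample_frac :: "nat set list \<Rightarrow> nat set set \<Rightarrow> nat set \<Rightarrow> real" where
  "sample_frac L G e = (\<Sum>N\<leftarrow>L. of_bool (agrees G e N)) / real (length L)"

lemma sample_frac_nonneg: "sample_frac L G e \<ge> 0"
  unfolding sample_frac_def by (auto intro!: divide_nonneg_nonneg sum_list_nonneg)

text \<open>The smoothed sample fractions are the probabilities of \<open>G\<close> in a model with independent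
  edges depending only on \<open>L\<close>.\<close>

lemma sum_Pow_prod_sample_frac:
  assumes "finite E" "L \<noteq> []" "\<eta> > 0"
  shows "(\<Sum>G\<in>Pow E. \<Prod>e\<in>E. (sample_frac L G e + \<eta>) / (1 + 2 * \<eta>)) = 1"
proof -
  \<comment> \<open>The edge probabilities before smoothing; membership of \<open>e\<close> in
    \<open>G\<close> merely switches between \<open>o' e\<close> and
    \<open>1 - o' e\<close>.\<close>
  define o' where "o' e = (\<Sum>N\<leftarrow>L. of_bool (odd (card (e \<inter> N)))) / real (length L)" for e :: "nat set"
  have compl: "(\<Sum>N\<leftarrow>L. of_bool (\<not> P N)) = real (length L) - (\<Sum>N\<leftarrow>L. of_bool (P N))" for P
    by (induction L) auto
  have "sample_frac L G e = (if e \<in> G then o' e else 1 - o' e)" for G e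
    using assms(2) by (simp add: sample_frac_def agrees_def o'_def compl diff_divide_distrib)
  hence "(\<Sum>G\<in>Pow E. \<Prod>e\<in>E. (sample_frac L G e + \<eta>) / (1 + 2 * \<eta>)) =
    (\<Sum>G\<in>Pow E. \<Prod>e\<in>E. if e \<in> G then (o' e + \<eta>) / (1 + 2 * \<eta>) else (1 - o' e + \<eta>) / (1 + 2 * \<eta>))"
    by (intro sum.cong prod.cong) auto
  also have "\<dots> = (\<Prod>e\<in>E. (o' e + \<eta>) / (1 + 2 * \<eta>) + (1 - o' e + \<eta>) / (1 + 2 * \<eta>))"
    by (rule sum_Pow_prod_if[OF assms(1)])
  also have "\<dots> = 1"
    using assms(3) by (intro prod.neutral) (auto simp: add_divide_distrib[symmetric])
  finally show ?thesis .
qed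

text \<open>With \<open>d = \<bar>q - p\<bar>\<close>, one has
  \<open>p \<le> (q + \<eta>) * (1 + d / \<eta>)\<close>, and the normalisation costs at most
  \<open>exp (2 * \<eta>)\<close>. The square of \<open>d - \<eta>\<^sup>2\<close> trades
  \<open>d / \<eta>\<close> for a term in \<open>d\<^sup>2\<close>, the quantity that sampling
  controls.\<close>

lemma smoothed_ratio_le:
  fixes p q \<eta> :: real
  assumes "q \<ge> 0" "\<eta> > 0"
  shows "p \<le> (q + \<eta>) / (1 + 2 * \<eta>) * exp (3 * \<eta> + (q - p)\<^sup>2 / \<eta> ^ 3)"
proof -
  define d where "d = \<bar>q - p\<bar>"
  have "2 * (d / \<eta>) \<le> \<eta> + d\<^sup>2 / \<eta> ^ 3"
  proof -
    have "0 \<le> (d - \<eta>\<^sup>2)\<^sup>2 / \<eta> ^ 3" using assms by simp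
    also have "\<dots> = \<eta> + d\<^sup>2 / \<eta> ^ 3 - 2 * (d / \<eta>)"
      using assms by (simp add: field_simps power2_eq_square power3_eq_cube)
    finally show ?thesis by simp
  qed
  moreover have "d / \<eta> \<ge> 0" using assms by (simp add: d_def)
  ultimately have d: "d / \<eta> \<le> \<eta> + d\<^sup>2 / \<eta> ^ 3" by linarith
  have "p \<le> q + d" by (simp add: d_def)
  also have "\<dots> \<le> (q + \<eta>) * (1 + d / \<eta>)"
    using assms by (simp add: field_simps d_def)
  also have "\<dots> = (q + \<eta>) / (1 + 2 * \<eta>) * ((1 + 2 * \<eta>) * (1 + d / \<eta>))"
    using assms by simp
  also have "\<dots> \<le> (q + \<eta>) / (1 + 2 * \<eta>) * (exp (2 * \<eta>) * exp (d / \<eta>))"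
    using assms \<open>d / \<eta> \<ge> 0\<close> by (intro mult_left_mono mult_mono exp_ge_add_one_self) auto
  also have "\<dots> \<le> (q + \<eta>) / (1 + 2 * \<eta>) * exp (3 * \<eta> + (q - p)\<^sup>2 / \<eta> ^ 3)"
    using assms d by (intro mult_left_mono) (auto simp: exp_add[symmetric] d_def)
  finally show ?thesis .
qed

section \<open>Sampling the neighbourhoods of a graph\<close>

lemma finite_edges: "finite (edges n)"
  by (rule finite_subset[of _ "Pow {1..n}"]) (auto simp: edges_def)

lemma card_edges_le: "card (edges n) \<le> n\<^sup>2"
proof -
  have "edges n \<subseteq> (\<lambda>(u, v). {u, v}) ` ({1..n} \<times> {1..n})"
  proof
    fix e assume "e \<in> edges n"
    hence "e \<subseteq> {1..n}" "card e = 2" by (auto simp: edges_def)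
    then obtain u v where "e = {u, v}" "u \<in> {1..n}" "v \<in> {1..n}" by (auto simp: card_2_iff)
    thus "e \<in> (\<lambda>(u, v). {u, v}) ` ({1..n} \<times> {1..n})" by (intro image_eqI[of _ _ "(u, v)"]) auto
  qed
  hence "card (edges n) \<le> card ({1..n} \<times> {1..n})" by (meson surj_card_le finite_SigmaI finite_atLeastAtMost)
  thus ?thesis by (simp add: power2_eq_square)
qed

lemma nbhd_subset: "G \<subseteq> edges n \<Longrightarrow> nbhd G w \<subseteq> {1..n}"
  by (auto simp: nbhd_def edges_def)

text \<open>The energy bound for the centred indicators \<open>y\<close> makes the squared
  deviations of the sample fractions sum to at most \<open>card (edges n) / s\<close>. Multiplying
  \<open>smoothed_ratio_le\<close> over all edges turns this into the exponent.\<close>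

lemma exists_good_sample:
  assumes "n > 0" "s > 0" "\<eta> > 0" "G \<subseteq> edges n"
  shows "\<exists>L\<in>{L. set L \<subseteq> Pow {1..n} \<and> length L = s}.
    (\<Prod>e\<in>edges n. agree_frac n G e) \<le>
    exp ((3 * \<eta> + 1 / (s * \<eta> ^ 3)) * (real n)\<^sup>2) *
    (\<Prod>e\<in>edges n. (sample_frac L G e + \<eta>) / (1 + 2 * \<eta>))"
proof -
  let ?E = "edges n"
  define y where "y e w = of_bool (agrees G e (nbhd G w)) - agree_frac n G e" for e w
  have frac: "agree_frac n G e = (\<Sum>w\<in>{1..n}. of_bool (agrees G e (nbhd G w))) / real n" for e
    by (simp add: agree_frac_def Int_def)
  have mean: "(\<Sum>w\<in>{1..n}. y e w) = 0" for e
    unfolding y_def sum_subtractf frac using assms(1) by simp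
  have "agree_frac n G e \<le> 1" for e
  proof -
    have "card {w \<in> {1..n}. agrees G e (nbhd G w)} \<le> card {1..n}" by (intro card_mono) auto
    thus ?thesis using assms(1) by (simp add: agree_frac_def)
  qed
  moreover have frac0: "agree_frac n G e \<ge> 0" for e by (simp add: agree_frac_def)
  ultimately have bound: "\<bar>y e w\<bar> \<le> 1" for e w
    unfolding y_def of_bool_def by (smt (verit))
  obtain xs where xs: "length xs = s" "set xs \<subseteq> {1..n}"
    "(\<Sum>e\<in>?E. (\<Sum>w\<leftarrow>xs. y e w)\<^sup>2) \<le> real s * real (card ?E)"
    using exists_sample_small_energy[of "{1..n}" ?E y s] mean bound assms(1) by auto
  define L where "L = map (nbhd G) xs"
  have len: "length L = s" using xs by (simp add: L_def)
  have dev: "sample_frac L G e - agree_frac n G e = (\<Sum>w\<leftarrow>xs. y e w) / real s" for e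
  proof -
    have "(\<Sum>w\<leftarrow>xs. y e w) = (\<Sum>w\<leftarrow>xs. of_bool (agrees G e (nbhd G w))) - real (length xs) * agree_frac n G e"
      unfolding y_def sum_list_subtractf by (simp add: sum_list_triv)
    thus ?thesis using assms(2) xs(1)
      by (simp add: sample_frac_def L_def o_def diff_divide_distrib)
  qed
  let ?q = "\<lambda>e. (sample_frac L G e + \<eta>) / (1 + 2 * \<eta>)"
  let ?D = "\<lambda>e. 3 * \<eta> + (sample_frac L G e - agree_frac n G e)\<^sup>2 / \<eta> ^ 3"
  have "(\<Prod>e\<in>?E. agree_frac n G e) \<le> (\<Prod>e\<in>?E. ?q e * exp (?D e))"
    using assms(3) frac0 by (intro prod_mono conjI smoothed_ratio_le sample_frac_nonneg) auto
  also have "\<dots> = exp (\<Sum>e\<in>?E. ?D e) * (\<Prod>e\<in>?E. ?q e)"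
    unfolding prod.distrib exp_sum[OF finite_edges] by (rule mult.commute)
  also have "\<dots> \<le> exp ((3 * \<eta> + 1 / (s * \<eta> ^ 3)) * (real n)\<^sup>2) * (\<Prod>e\<in>?E. ?q e)"
  proof (intro mult_right_mono prod_nonneg ballI)
    have "(\<Sum>e\<in>?E. ?D e) = 3 * \<eta> * card ?E + (\<Sum>e\<in>?E. (\<Sum>w\<leftarrow>xs. y e w)\<^sup>2) / (s\<^sup>2 * \<eta> ^ 3)"
      unfolding dev by (simp add: sum.distrib sum_divide_distrib power_divide)
    also have "\<dots> \<le> 3 * \<eta> * card ?E + (real s * real (card ?E)) / (s\<^sup>2 * \<eta> ^ 3)"
      using xs(3) assms by (intro add_mono divide_right_mono) auto
    also have "\<dots> = (3 * \<eta> + 1 / (s * \<eta> ^ 3)) * card ?E"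
      using assms by (simp add: field_simps power2_eq_square)
    also have "\<dots> \<le> (3 * \<eta> + 1 / (s * \<eta> ^ 3)) * (real n)\<^sup>2"
      using assms card_edges_le[of n] by (intro mult_left_mono) (auto simp: of_nat_power[symmetric] simp del: of_nat_power)
    finally show "exp (\<Sum>e\<in>?E. ?D e) \<le> exp ((3 * \<eta> + 1 / (s * \<eta> ^ 3)) * (real n)\<^sup>2)" by simp
    show "?q e \<ge> 0" for e using assms sample_frac_nonneg[of L G e] by simp
  qed
  finally show ?thesis using nbhd_subset[OF assms(4)] len
    by (intro bexI[of _ L]) (auto simp: L_def)
qed

text \<open>The good sample of each \<open>G\<close> is replaced by the sum over all lists of length
  \<open>k ^ 4\<close>. After exchanging the sums each list contributes the same exponential factor,
  since its weights have total mass 1.\<close>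

lemma sum_prod_agree_frac_le:
  assumes "n > 0" "k > 0"
  shows "(\<Sum>G\<in>Pow (edges n). \<Prod>e\<in>edges n. agree_frac n G e)
    \<le> 2 ^ (n * k ^ 4) * exp (4 / k * (real n)\<^sup>2)"
proof -
  define \<eta> where "\<eta> = 1 / real k"
  let ?LL = "{L. set L \<subseteq> Pow {1..n} \<and> length L = k ^ 4}"
  let ?q = "\<lambda>L G e. (sample_frac L G e + \<eta>) / (1 + 2 * \<eta>)"
  let ?C = "exp (4 / k * (real n)\<^sup>2)"
  \<comment> \<open>Sample size \<open>k ^ 4\<close> and \<open>\<eta> = 1 / k\<close> balance the
    errors: \<open>3 / k\<close> from smoothing and \<open>1 / k\<close> from sampling.\<close>
  have \<eta>: "\<eta> > 0" "3 * \<eta> + 1 / (real (k ^ 4) * \<eta> ^ 3) = 4 / k"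
    using assms by (auto simp: \<eta>_def field_simps power_eq_if)
  have finLL: "finite ?LL" by (rule finite_lists_length_eq) simp
  have nonneg: "(\<Prod>e\<in>edges n. ?q L G e) \<ge> 0" for L G
    using \<eta>(1) sample_frac_nonneg by (intro prod_nonneg) (auto intro!: divide_nonneg_nonneg add_nonneg_nonneg)
  have "(\<Sum>G\<in>Pow (edges n). \<Prod>e\<in>edges n. agree_frac n G e) \<le>
    (\<Sum>G\<in>Pow (edges n). \<Sum>L\<in>?LL. ?C * (\<Prod>e\<in>edges n. ?q L G e))"
  proof (rule sum_mono)
    fix G assume "G \<in> Pow (edges n)"
    hence "\<exists>L\<in>?LL. (\<Prod>e\<in>edges n. agree_frac n G e) \<le> ?C * (\<Prod>e\<in>edges n. ?q L G e)"
      using exists_good_sample[of n "k ^ 4" \<eta> G] assms \<eta> by simp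
    then obtain L where L: "L \<in> ?LL" "(\<Prod>e\<in>edges n. agree_frac n G e) \<le> ?C * (\<Prod>e\<in>edges n. ?q L G e)"
      by blast
    note L(2)
    also have "?C * (\<Prod>e\<in>edges n. ?q L G e) \<le> (\<Sum>L\<in>?LL. ?C * (\<Prod>e\<in>edges n. ?q L G e))"
      using L(1) finLL nonneg by (intro member_le_sum) auto
    finally show "(\<Prod>e\<in>edges n. agree_frac n G e) \<le> (\<Sum>L\<in>?LL. ?C * (\<Prod>e\<in>edges n. ?q L G e))" .
  qed
  also have "\<dots> = (\<Sum>L\<in>?LL. ?C * (\<Sum>G\<in>Pow (edges n). \<Prod>e\<in>edges n. ?q L G e))"
    by (subst sum.swap) (simp add: sum_distrib_left)
  also have "\<dots> = (\<Sum>L\<in>?LL. ?C)"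
    using assms \<eta>(1) by (intro sum.cong refl) (subst sum_Pow_prod_sample_frac, auto simp: finite_edges)
  also have "\<dots> = 2 ^ (n * k ^ 4) * ?C"
    by (simp add: card_lists_length_eq card_Pow power_mult)
  finally show ?thesis .
qed

section \<open>Homology and cocycles\<close>

text \<open>Coordinates in a basis give a bijection; a finite basis exists because the finite
  carrier spans.\<close>

lemma (in vectorspace) card_carrier_eq_power_dim:
  assumes "finite (carrier V)"
  shows "card (carrier V) = card (carrier K) ^ dim"
proof -
  have "span (carrier V) = carrier V"
    using in_own_span[of "carrier V"] span_is_subset2[of "carrier V"] by auto
  hence "fin_dim" using assms unfolding fin_dim_def by blast
  then obtain A where A: "finite A" "basis A" using finite_basis_exists by blast
  hence AV: "A \<subseteq> carrier V" by (simp add: basis_def)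
  have uniq: "\<exists>!a. a \<in> A \<rightarrow>\<^sub>E carrier K \<and> lincomb a A = v" if "v \<in> carrier V" for v
    using basis_criterion[OF A(1) AV] A(2) that by blast
  have closed: "lincomb a A \<in> carrier V" if "a \<in> A \<rightarrow>\<^sub>E carrier K" for a
    using that AV by (intro lincomb_closed) auto
  have "bij_betw (\<lambda>a. lincomb a A) (A \<rightarrow>\<^sub>E carrier K) (carrier V)"
    unfolding bij_betw_def inj_on_def using uniq closed by (auto simp: image_iff) metis+
  hence "card (carrier V) = card (A \<rightarrow>\<^sub>E carrier K)" by (metis bij_betw_same_card)
  thus ?thesis using A dim_basis by (simp add: card_PiE)
qed

text \<open>The nontrivial character of the additive group of the two-element field.\<close>

definition bit_sign :: "bit \<Rightarrow> real" where
  "bit_sign a = (if a = 0 then 1 else - 1)"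

lemma bit_sign_add: "bit_sign (a + b) = bit_sign a * bit_sign b"
  by (cases a; cases b) (auto simp: bit_sign_def)

lemma bit_sign_sum: "bit_sign (\<Sum>e\<in>G. b e) = (\<Prod>e\<in>G. bit_sign (b e))"
  by (induction G rule: infinite_finite_induct) (auto simp: bit_sign_add, auto simp: bit_sign_def)

text \<open>Both sides count \<open>\<Sum>G. \<Sum>b. (-1) ^ \<langle>G, b\<rangle>\<close>, by orthogonality of characters.\<close>

lemma card_annihilator:
  fixes B :: "('a \<Rightarrow> bit) set"
  assumes "finite E" "finite B" "(\<lambda>_. 0) \<in> B"
    and add: "\<And>b c. b \<in> B \<Longrightarrow> c \<in> B \<Longrightarrow> (\<lambda>e. b e + c e) \<in> B"
    and supp: "\<And>b e. b \<in> B \<Longrightarrow> b e \<noteq> 0 \<Longrightarrow> e \<in> E"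
  shows "card B * card {G \<in> Pow E. \<forall>b\<in>B. (\<Sum>e\<in>G. b e) = 0} = 2 ^ card E"
proof -
  let ?D = "{G \<in> Pow E. \<forall>b\<in>B. (\<Sum>e\<in>G. b e) = 0}"
  have "(\<Sum>b\<in>B. bit_sign (\<Sum>e\<in>G. b e)) = (if G \<in> ?D then real (card B) else 0)" if G: "G \<in> Pow E" for G
  proof (cases "G \<in> ?D")
    case True
    hence "(\<Sum>b\<in>B. bit_sign (\<Sum>e\<in>G. b e)) = (\<Sum>b\<in>B. 1)" by (intro sum.cong) (auto simp: bit_sign_def)
    thus ?thesis using True by simp
  next
    case False
    then obtain c where c: "c \<in> B" "(\<Sum>e\<in>G. c e) \<noteq> 0" using G by auto
    have sgn_c: "bit_sign (\<Sum>e\<in>G. c e) = - 1" using c(2) by (simp add: bit_sign_def)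
    \<comment> \<open>Translation by \<open>c\<close> permutes \<open>B\<close> and flips every
      sign, so the character sum equals its own negative.\<close>
    define t where "t b = (\<lambda>e. b e + c e)" for b
    have tt: "t (t b) = b" for b
      unfolding t_def by (simp only: add.assoc bit_add_self add_0_right)
    have "bij_betw t B B"
      by (rule bij_betw_byWitness[where f' = t]) (use add c(1) tt in \<open>auto simp: t_def\<close>)
    hence "(\<Sum>b\<in>B. bit_sign (\<Sum>e\<in>G. b e)) = (\<Sum>b\<in>B. bit_sign (\<Sum>e\<in>G. t b e))"
      by (rule sum.reindex_bij_betw[symmetric])
    also have "\<dots> = - (\<Sum>b\<in>B. bit_sign (\<Sum>e\<in>G. b e))"
      unfolding t_def sum.distrib bit_sign_add sgn_c by (simp add: sum_negf)
    finally have "(\<Sum>b\<in>B. bit_sign (\<Sum>e\<in>G. b e)) = 0" by simp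
    thus ?thesis by (simp only: False if_False)
  qed
  hence "(\<Sum>G\<in>Pow E. \<Sum>b\<in>B. bit_sign (\<Sum>e\<in>G. b e)) = (\<Sum>G\<in>Pow E. if G \<in> ?D then real (card B) else 0)"
    by (intro sum.cong) auto
  also have "\<dots> = real (card B) * real (card ?D)"
    using assms(1) by (simp add: sum.inter_filter[symmetric] mult.commute)
  finally have 1: "(\<Sum>G\<in>Pow E. \<Sum>b\<in>B. bit_sign (\<Sum>e\<in>G. b e)) = real (card B) * real (card ?D)" .
  have "(\<Sum>G\<in>Pow E. bit_sign (\<Sum>e\<in>G. b e)) = (if b = (\<lambda>_. 0) then 2 ^ card E else 0)" if b: "b \<in> B" for b
  proof -
    have "(\<Sum>G\<in>Pow E. bit_sign (\<Sum>e\<in>G. b e)) = (\<Prod>e\<in>E. bit_sign (b e) + 1)"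
      by (simp add: prod_add[OF assms(1)] bit_sign_sum)
    also have "\<dots> = (if b = (\<lambda>_. 0) then 2 ^ card E else 0)"
    proof (cases "b = (\<lambda>_. 0)")
      case False
      \<comment> \<open>The factor at such an \<open>e\<close> is \<open>- 1 + 1\<close>.\<close>
      then obtain e where "b e \<noteq> 0" by blast
      hence "e \<in> E" "bit_sign (b e) + 1 = 0" using supp[OF b] by (auto simp: bit_sign_def)
      thus ?thesis using False assms(1) prod_zero by (metis (mono_tags, lifting))
    qed (simp add: bit_sign_def)
    finally show ?thesis .
  qed
  hence "(\<Sum>b\<in>B. \<Sum>G\<in>Pow E. bit_sign (\<Sum>e\<in>G. b e)) = (\<Sum>b\<in>B. if b = (\<lambda>_. 0) then 2 ^ card E else 0)"
    by (intro sum.cong) auto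
  also have "\<dots> = 2 ^ card E" using assms(2,3) by simp
  finally have "real (card B) * real (card ?D) = 2 ^ card E" using 1
    unfolding sum.swap[of "\<lambda>b G. bit_sign (sum b G)" "Pow E" B] by simp
  thus ?thesis by (metis (mono_tags, lifting) of_nat_eq_iff of_nat_mult of_nat_numeral of_nat_power)
qed

text \<open>A cochain is represented by its support \<open>G\<close>, and the cocycle condition by
  orthogonality to all boundaries, which is the form \<open>card_annihilator\<close> counts.\<close>

definition F2_cocycles :: "'v set set \<Rightarrow> nat \<Rightarrow> 'v set set set" where
  "F2_cocycles K k = {G \<in> Pow (faces K k). \<forall>b\<in>F2_boundaries K k. (\<Sum>e\<in>G. b e) = 0}"

lemma card_F2_chains:
  assumes "finite (faces K k)"
  shows "finite (carrier (F2_chains K k))" "card (carrier (F2_chains K k)) = 2 ^ card (faces K k)"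
proof -
  have "bij_betw (\<lambda>c. {\<sigma>. c \<sigma> \<noteq> (0::bit)}) (carrier (F2_chains K k)) (Pow (faces K k))"
    by (rule bij_betw_byWitness[where f' = "\<lambda>S \<sigma>. of_bool (\<sigma> \<in> S)"])
      (use assms in \<open>auto simp: fun_eq_iff of_bool_def finite_subset\<close>)
  thus "finite (carrier (F2_chains K k))" "card (carrier (F2_chains K k)) = 2 ^ card (faces K k)"
    using assms bij_betw_finite bij_betw_same_card card_Pow by (metis finite_Pow_iff, metis)
qed

text \<open>Write H, Z, B, C for homology, cycles, boundaries, chains. Lagrange and
  \<open>card_annihilator\<close> give |H| |B| = |Z| \<le> |C| = |B| times the number of cocycles;
  then |B| cancels.\<close>

lemma two_power_F2_homology_dim_le:
  assumes "simplicial_complex K" "finite (faces K k)"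
  shows "2 ^ F2_homology_dim K k \<le> card (F2_cocycles K k)"
proof -
  let ?Z = "F2_cycles K k" and ?B = "F2_boundaries K k" and ?H = "F2_homology K k"
  interpret Z: Module.module "class_ring :: bit ring" ?Z by (rule module_F2_cycles)
  interpret B: Module.submodule ?B "class_ring :: bit ring" ?Z by (rule submodule_F2_boundaries[OF assms(1)])
  interpret H: vectorspace "class_ring :: bit ring" ?H by (rule vectorspace_F2_homology[OF assms(1)])
  have Zsub: "carrier ?Z \<subseteq> carrier (F2_chains K k)" by (auto simp: F2_cycles_def)
  have finZ: "finite (carrier ?Z)" using Zsub card_F2_chains(1)[OF assms(2)] finite_subset by blast
  have BZ: "?B \<subseteq> carrier ?Z" using B.subset by simp
  have finB: "finite ?B" using BZ finZ finite_subset by blast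
  have carH: "carrier ?H = rcosets\<^bsub>add_monoid ?Z\<^esub> ?B"
    by (simp add: F2_homology_def quot_module_def A_RCOSETS_def)
  have "group (add_monoid ?Z)" by (rule Z.a_group)
  hence lagrange: "card (carrier ?H) * card ?B = card (carrier ?Z)"
    unfolding carH using group.lagrange[of "add_monoid ?Z" ?B] B.subgroup_axioms
    by (simp add: Coset.order_def)
  have finH: "finite (carrier ?H)"
    unfolding carH RCOSETS_def using finZ by simp
  have "zero ?Z = (\<lambda>_. 0)" by (simp add: F2_cycles_def)
  hence zero: "(\<lambda>_. 0) \<in> ?B" using B.one_closed by simp
  have add: "(\<lambda>e. b e + c e) \<in> ?B" if "b \<in> ?B" "c \<in> ?B" for b c
    using B.m_closed[OF that] by (simp add: F2_cycles_def)
  have supp: "e \<in> faces K k" if "b \<in> ?B" "b e \<noteq> 0" for b e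
  proof -
    have "b \<in> carrier (F2_chains K k)" using that(1) BZ Zsub by blast
    thus ?thesis using that(2) by (simp only: F2_chains_simps) blast
  qed
  have ann: "card ?B * card (F2_cocycles K k) = 2 ^ card (faces K k)"
    unfolding F2_cocycles_def by (rule card_annihilator[OF assms(2) finB zero add supp])
  have "card (carrier ?H) * card ?B \<le> card (F2_cocycles K k) * card ?B"
    using lagrange ann card_F2_chains[OF assms(2)] card_mono[OF _ Zsub] by (simp add: mult.commute)
  moreover have "card ?B > 0" using zero finB card_gt_0_iff by blast
  ultimately have "card (carrier ?H) \<le> card (F2_cocycles K k)" by simp
  moreover have "card (carrier ?H) = card (UNIV :: bit set) ^ H.dim"
    using H.card_carrier_eq_power_dim[OF finH] by simp
  moreover have "card (UNIV :: bit set) = 2"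
  proof -
    have "(UNIV :: bit set) = {0, 1}" using bit.exhaust by blast
    thus ?thesis by (metis card_2_iff zero_neq_one)
  qed
  ultimately show ?thesis by (simp add: F2_homology_dim_def)
qed

section \<open>Cocycles of the 1-out complex\<close>

lemma faces_one_out_complex:
  assumes "\<And>e. e \<in> edges n \<Longrightarrow> f e \<in> {1..n} - e"
  shows "faces (one_out_complex n f) 1 = edges n"
proof -
  have "card (insert (f e) e) = 3" if "e \<in> edges n" for e
  proof -
    have "finite e" using that by (auto simp: edges_def intro: finite_subset)
    thus ?thesis using assms[OF that] that by (auto simp: edges_def)
  qed
  thus ?thesis by (auto simp: faces_def one_out_complex_def complete_graph_def) (auto simp: edges_def)
qed

lemma F2_boundary_indicator:
  "F2_boundary (\<lambda>\<sigma>. of_bool (\<sigma> = t)) \<tau> = of_bool (\<tau> \<noteq> {} \<and> \<tau> \<subset> t \<and> card t = Suc (card \<tau>))"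
proof (cases "\<tau> = {}")
  case False
  thus ?thesis by (subst F2_boundary_eq_sum[of "{t}"]) auto
qed (simp add: F2_boundary_def)

text \<open>The cocycle is tested on the boundary of the single triangle chosen at
  \<open>e\<close>.\<close>

lemma F2_cocycle_agrees:
  assumes "\<And>e. e \<in> edges n \<Longrightarrow> f e \<in> {1..n} - e"
    and G: "G \<in> F2_cocycles (one_out_complex n f) 1" and e: "e \<in> edges n"
  shows "agrees G e (nbhd G (f e))"
proof -
  define w where "w = f e"
  define t where "t = insert w e"
  obtain u v where uv: "e = {u, v}" "u \<noteq> v" using e by (auto simp: edges_def card_2_iff)
  have w: "w \<noteq> u" "w \<noteq> v" using assms(1)[OF e] uv by (auto simp: w_def)
  have t: "t = {u, v, w}" using uv by (auto simp: t_def)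
  have ct: "card t = 3" using uv w by (simp add: t)
  have "t \<in> faces (one_out_complex n f) (Suc 1)"
    using e ct by (auto simp: faces_def one_out_complex_def t_def w_def)
  hence "F2_boundary (\<lambda>\<sigma>. of_bool (\<sigma> = t)) \<in> F2_boundaries (one_out_complex n f) 1"
    unfolding F2_boundaries_def by (intro imageI) (auto simp: of_bool_def)
  hence pairing: "(\<Sum>e\<in>G. F2_boundary (\<lambda>\<sigma>. of_bool (\<sigma> = t)) e) = 0"
    using G by (auto simp: F2_cocycles_def)
  have GE: "G \<subseteq> edges n" using G faces_one_out_complex[OF assms(1)] by (auto simp: F2_cocycles_def)
  have finG: "finite G" using GE finite_edges finite_subset by blast
  have ne: "{u, v} \<noteq> {u, w}" "{u, v} \<noteq> {v, w}" "{u, w} \<noteq> {v, w}"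
    using uv(2) w by (auto simp: doubleton_eq_iff)
  have parity_iff: "(of_bool P + of_bool Q + of_bool R :: bit) = 0 \<longleftrightarrow> (P \<longleftrightarrow> Q \<noteq> R)" for P Q R
    by (cases P; cases Q; cases R) simp_all
  have sub: "\<tau> \<subset> t \<longleftrightarrow> \<tau> \<in> {{u, v}, {u, w}, {v, w}}" if "\<tau> \<in> G" for \<tau>
  proof
    assume *: "\<tau> \<subset> t"
    have "card \<tau> = 2" using that GE by (auto simp: edges_def)
    then obtain a b where ab: "\<tau> = {a, b}" "a \<noteq> b" by (auto simp: card_2_iff)
    have "a \<in> {u, v, w}" "b \<in> {u, v, w}" using * unfolding ab t by auto
    thus "\<tau> \<in> {{u, v}, {u, w}, {v, w}}"
      using ab(2) unfolding ab(1) by (elim insertE emptyE) (simp_all add: insert_commute)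
  next
    assume "\<tau> \<in> {{u, v}, {u, w}, {v, w}}"
    thus "\<tau> \<subset> t" using uv w unfolding t by auto
  qed
  have "(\<Sum>e\<in>G. F2_boundary (\<lambda>\<sigma>. of_bool (\<sigma> = t)) e)
    = (\<Sum>\<tau>\<in>G. of_bool (\<tau> \<in> {{u, v}, {u, w}, {v, w}}))"
  proof (rule sum.cong[OF refl])
    fix \<tau> assume \<tau>: "\<tau> \<in> G"
    hence "card \<tau> = 2" using GE by (auto simp: edges_def)
    thus "F2_boundary (\<lambda>\<sigma>. of_bool (\<sigma> = t)) \<tau> = of_bool (\<tau> \<in> {{u, v}, {u, w}, {v, w}})"
      unfolding F2_boundary_indicator sub[OF \<tau>, symmetric] using ct by auto
  qed
  \<comment> \<open>Both sums count the sides of \<open>t\<close> that lie in \<open>G\<close>; the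
    new index set has just three elements.\<close>
  also have "\<dots> = (\<Sum>\<tau>\<in>{{u, v}, {u, w}, {v, w}}. of_bool (\<tau> \<in> G))"
    unfolding of_bool_def sum.inter_restrict[OF finG, symmetric]
    by (subst sum.inter_restrict[symmetric]) (simp_all only: finite.intros Int_commute)
  also have "\<dots> = of_bool ({u, v} \<in> G) + of_bool ({u, w} \<in> G) + of_bool ({v, w} \<in> G)"
    using ne by (simp add: add.assoc del: add_bit_eq_xor)
  finally have "(of_bool ({u, v} \<in> G) + of_bool ({u, w} \<in> G) + of_bool ({v, w} \<in> G) :: bit) = 0"
    by (simp only: pairing)
  hence parity: "{u, v} \<in> G \<longleftrightarrow> ({u, w} \<in> G) \<noteq> ({v, w} \<in> G)"
    by (simp only: parity_iff)
  have "e \<inter> nbhd G w = (if {u, w} \<in> G then {u} else {}) \<union> (if {v, w} \<in> G then {v} else {})"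
    using uv by (auto simp: nbhd_def)
  hence "odd (card (e \<inter> nbhd G w)) \<longleftrightarrow> ({u, w} \<in> G) \<noteq> ({v, w} \<in> G)"
    using uv(2) by auto
  thus ?thesis using parity uv(1) by (simp add: agrees_def w_def)
qed

section \<open>The first moment bound\<close>

lemma card_edge_complement:
  assumes "e \<in> edges n"
  shows "card ({1..n} - e) = n - 2"
proof -
  have "e \<subseteq> {1..n}" "card e = 2" using assms by (auto simp: edges_def)
  moreover from this have "finite e" using finite_subset by blast
  ultimately show ?thesis by (simp add: card_Diff_subset)
qed

lemma edge_complement_nonempty:
  assumes "e \<in> edges n" "n \<ge> 3"
  shows "{1..n} - e \<noteq> {}"
proof -
  have "card ({1..n} - e) > 0" using card_edge_complement[OF assms(1)] assms(2) by linarith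
  thus ?thesis by (metis card.empty less_irrefl)
qed

text \<open>Enlarging the range of \<open>w\<close> from \<open>{1..n} - e\<close> to \<open>{1..n}\<close> only increases the fraction, since
  both endpoints of \<open>e\<close> agree with \<open>e\<close>.\<close>

lemma prob_agrees_le_agree_frac:
  assumes "n \<ge> 3" "G \<subseteq> edges n" "e \<in> edges n"
  shows "measure_pmf.prob (pmf_of_set ({1..n} - e)) {w. agrees G e (nbhd G w)} \<le> agree_frac n G e"
proof -
  obtain u v where uv: "e = {u, v}" "u \<noteq> v" using assms(3) by (auto simp: edges_def card_2_iff)
  have sub: "e \<subseteq> {1..n}" using assms(3) by (simp add: edges_def)
  \<comment> \<open>Without loops no vertex is its own neighbour, so an endpoint of \<open>e\<close>
    sees at most the other endpoint.\<close>
  have loop: "{x} \<notin> G" for x using assms(2) by (auto simp: edges_def)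
  have "e \<inter> nbhd G u = (if e \<in> G then {v} else {})" "e \<inter> nbhd G v = (if e \<in> G then {u} else {})"
    using uv loop by (auto simp: nbhd_def insert_commute)
  hence endp: "agrees G e (nbhd G w)" if "w \<in> e" for w
    using that uv(1) by (auto simp: agrees_def split: if_splits)
  define c where "c = card (({1..n} - e) \<inter> {w. agrees G e (nbhd G w)})"
  have "{w \<in> {1..n}. agrees G e (nbhd G w)} = (({1..n} - e) \<inter> {w. agrees G e (nbhd G w)}) \<union> e"
    using endp sub by auto
  also have "card \<dots> = c + card e"
    unfolding c_def using sub by (intro card_Un_disjoint) (auto intro: finite_subset)
  finally have frac: "agree_frac n G e = (c + 2) / n"
    using assms(3) by (simp add: agree_frac_def edges_def)
  have "c \<le> card ({1..n} - e)" unfolding c_def by (intro card_mono) auto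
  hence c: "c \<le> n - 2" using card_edge_complement[OF assms(3)] by simp
  have "{1..n} - e \<noteq> {}" using edge_complement_nonempty assms by blast
  hence "measure_pmf.prob (pmf_of_set ({1..n} - e)) {w. agrees G e (nbhd G w)} = c / (n - 2)"
    unfolding c_def card_edge_complement[OF assms(3), symmetric] by (intro measure_pmf_of_set) auto
  also have "\<dots> \<le> (c + 2) / n"
  proof -
    \<comment> \<open>This removes the truncated subtraction; the claim becomes
      \<open>c \<le> m\<close>.\<close>
    define m where "m = n - 2"
    have "n = m + 2" "m > 0" using assms(1) by (auto simp: m_def)
    thus ?thesis using c by (simp add: field_simps)
  qed
  finally show ?thesis by (simp add: frac)
qed

text \<open>Markov's inequality for \<open>X\<close>, which dominates the number of cocycles and
  hence \<open>2 ^ F2_homology_dim K 1\<close>.\<close>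

lemma prob_F2_homology_dim_le:
  assumes "n \<ge> 3" "k > 0"
  shows "measure_pmf.prob (S2_1 n) {K. \<bar>real (F2_homology_dim K 1) / (real n)\<^sup>2 - 0\<bar> > \<epsilon>}
    \<le> 2 ^ (n * k ^ 4) * exp (4 / k * (real n)\<^sup>2) / 2 powr (\<epsilon> * (real n)\<^sup>2)"
proof -
  define P where "P = Pi_pmf (edges n) 0 (\<lambda>e. pmf_of_set ({1..n} - e))"
  \<comment> \<open>A product event containing every \<open>f\<close> in the support of
    \<open>P\<close> for which \<open>G\<close> is a cocycle.\<close>
  define A where "A G = Pi (edges n) (\<lambda>e. {w. agrees G e (nbhd G w)})" for G
  define X :: "(nat set \<Rightarrow> nat) \<Rightarrow> real" where "X f = (\<Sum>G\<in>Pow (edges n). indicator (A G) f)" for f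
  let ?a = "2 powr (\<epsilon> * (real n)\<^sup>2)"
  have supp: "f e \<in> {1..n} - e" if "f \<in> set_pmf P" "e \<in> edges n" for f e
  proof -
    have "{1..n} - e \<noteq> {}" using edge_complement_nonempty that(2) assms(1) by blast
    moreover have "f e \<in> set_pmf (pmf_of_set ({1..n} - e))"
      using that unfolding P_def set_Pi_pmf[OF finite_edges] by (auto simp: PiE_dflt_def)
    ultimately show ?thesis by (simp add: set_pmf_of_set)
  qed
  have large: "X f \<ge> ?a"
    if f: "f \<in> set_pmf P" and dim: "\<bar>real (F2_homology_dim (one_out_complex n f) 1) / (real n)\<^sup>2 - 0\<bar> > \<epsilon>" for f
  proof -
    let ?K = "one_out_complex n f"
    note sf = supp[OF f]
    have "\<epsilon> * (real n)\<^sup>2 \<le> real (F2_homology_dim ?K 1)"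
      using dim assms(1) by (simp add: field_simps)
    hence "?a \<le> 2 ^ F2_homology_dim ?K 1" by (simp flip: powr_realpow)
    also have "\<dots> \<le> real (card (F2_cocycles ?K 1))"
      using two_power_F2_homology_dim_le[OF simplicial_complex_one_out_complex[OF sf], of 1]
        faces_one_out_complex[OF sf] finite_edges by (simp add: numeral_power_le_of_nat_cancel_iff)
    also have "\<dots> \<le> real (card {G \<in> Pow (edges n). f \<in> A G})"
    proof -
      have "F2_cocycles ?K 1 \<subseteq> {G \<in> Pow (edges n). f \<in> A G}"
        using F2_cocycle_agrees[OF sf] faces_one_out_complex[OF sf] by (auto simp: A_def F2_cocycles_def)
      thus ?thesis by (simp add: card_mono finite_edges)
    qed
    also have "\<dots> = X f" by (simp add: X_def indicator_def sum.If_cases finite_edges Int_def)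
    finally show ?thesis .
  qed
  have int: "integrable P (\<lambda>f. indicator (A G) f :: real)" for G
    by (simp add: measure_pmf.emeasure_eq_measure)
  have nonnegX: "X f \<ge> 0" for f by (simp add: X_def sum_nonneg)
  have intX: "integrable P X" unfolding X_def using int by (intro Bochner_Integration.integrable_sum)
  have "measure_pmf.prob (S2_1 n) {K. \<bar>real (F2_homology_dim K 1) / (real n)\<^sup>2 - 0\<bar> > \<epsilon>} =
    measure_pmf.prob P {f. \<bar>real (F2_homology_dim (one_out_complex n f) 1) / (real n)\<^sup>2 - 0\<bar> > \<epsilon>}"
    by (simp add: S2_1_def P_def vimage_def)
  also have "\<dots> \<le> measure_pmf.prob P {f. X f \<ge> ?a}"
    using large by (intro measure_pmf.finite_measure_mono_AE) (auto simp: AE_measure_pmf_iff)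
  also have "\<dots> \<le> measure_pmf.expectation P X / ?a"
    using integral_Markov_inequality_measure[OF intX, of "{}" ?a] nonnegX by simp
  also have "measure_pmf.expectation P X = (\<Sum>G\<in>Pow (edges n). measure_pmf.prob P (A G))"
    unfolding X_def using int by (simp add: Bochner_Integration.integral_sum)
  \<comment> \<open>Independence of the choices factorises the probability of each
    \<open>A G\<close>.\<close>
  also have "\<dots> \<le> (\<Sum>G\<in>Pow (edges n). \<Prod>e\<in>edges n. agree_frac n G e)"
    unfolding P_def A_def measure_Pi_pmf_Pi[OF finite_edges]
    using assms(1) prob_agrees_le_agree_frac by (intro sum_mono prod_mono) auto
  also have "\<dots> \<le> 2 ^ (n * k ^ 4) * exp (4 / k * (real n)\<^sup>2)"
    using assms by (intro sum_prod_agree_frac_le) auto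
  finally show ?thesis by (simp add: divide_right_mono)
qed

theorem theorem2:
  shows "\<forall>\<epsilon>::real. \<epsilon> > 0 \<longrightarrow>
    (\<lambda>n. measure_pmf.prob (S2_1 n)
       {K. \<bar>real (F2_homology_dim K 1) / (real n)\<^sup>2 - 0\<bar> > \<epsilon>}) \<longlonglongrightarrow> 0"
proof (intro allI impI)
  fix \<epsilon> :: real assume \<epsilon>: "\<epsilon> > 0"
  \<comment> \<open>Change of base:
    \<open>2 powr (\<epsilon> * x) = exp (\<delta> * x)\<close>.\<close>
  define \<delta> where "\<delta> = \<epsilon> * ln 2"
  have \<delta>: "\<delta> > 0" using \<epsilon> by (simp add: \<delta>_def)
  \<comment> \<open>With \<open>4 / k \<le> \<delta> / 2\<close>, half of the quadratic decay
    survives and beats the linear term \<open>C * n\<close>.\<close>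
  obtain k :: nat where k: "8 / \<delta> < k" using reals_Archimedean2 by blast
  hence k0: "k > 0" using \<delta> by (metis divide_pos_pos less_trans of_nat_0_less_iff zero_less_numeral)
  have k4: "4 / real k \<le> \<delta> / 2" using k k0 \<delta> by (simp add: field_simps)
  define C where "C = real (k ^ 4) * ln 2"
  let ?p = "\<lambda>n. measure_pmf.prob (S2_1 n) {K. \<bar>real (F2_homology_dim K 1) / (real n)\<^sup>2 - 0\<bar> > \<epsilon>}"
  have "?p n \<le> exp (C * real n - \<delta> / 2 * (real n)\<^sup>2)" if "n \<ge> 3" for n
  proof -
    have "2 ^ (n * k ^ 4) = exp (C * real n)"
      by (simp add: C_def powr_def mult_ac flip: powr_realpow)
    moreover have "2 powr (\<epsilon> * (real n)\<^sup>2) = exp (\<delta> * (real n)\<^sup>2)"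
      by (simp add: \<delta>_def powr_def mult_ac)
    ultimately have "?p n \<le> exp (C * real n + 4 / k * (real n)\<^sup>2 - \<delta> * (real n)\<^sup>2)"
      using prob_F2_homology_dim_le[OF that k0, of \<epsilon>] by (simp add: exp_add exp_diff)
    also have "\<dots> \<le> exp (C * real n - \<delta> / 2 * (real n)\<^sup>2)"
      using mult_right_mono[OF k4, of "(real n)\<^sup>2"] by simp
    finally show ?thesis .
  qed
  hence "\<forall>\<^sub>F n in sequentially. ?p n \<le> exp (C * real n - \<delta> / 2 * (real n)\<^sup>2)"
    by (intro eventually_sequentiallyI[of 3]) auto
  moreover have "(\<lambda>n. exp (C * real n - \<delta> / 2 * (real n)\<^sup>2)) \<longlonglongrightarrow> 0"
    using \<delta> by real_asymp
  ultimately show "?p \<longlonglongrightarrow> 0"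
    by (rule tendsto_sandwich[OF always_eventually[OF allI[OF measure_nonneg]] _ tendsto_const])
qed

end
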